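(* Let $n \ge 1$ be an integer, let $p(\lambda) = \lambda^n + a_2\lambda^{n-1} + a_3\lambda^{n-2} + \cdots + a_n\lambda + a_{n+1}$ be a monic polynomial with real coefficients $a_2,\dots,a_{n+1}$, and let $C \in \mathbb{C}^{n\times n}$ be its companion matrix. If $\lambda_1$ is a dominant eigenvalue of $C$, then all the complex roots of $p$ lie within the circle of radius $r = |\lambda_1|$ in the complex plane, that is, every $z \in \mathbb{C}$ with $p(z)=0$ satisfies $|z| \le |\lambda_1|$.
   Context: Coefficients are indexed so that $a_k$ is the coefficient of $\lambda^{n-k+1}$ for $2 \le k \le n+1$, the leading coefficient being $1$. The companion matrix of $p$ is the $n\times n$ matrix $$C = \begin{bmatrix} -a_2 & -a_3 & \cdots & -a_n & -a_{n+1} \\ 1 & 0 & \cdots & 0 & 0 \\ 0 & 1 & \cdots & 0 & 0 \\ \vdots & & \ddots & & \vdots \\ 0 & 0 & \cdots & 1 & 0 \end{bmatrix},$$ whose first row is $(-a_2,-a_3,\dots,-a_{n+1})$, whose subdiagonal entries are all $1$, and whose other entries are $0$ (for $n=1$, $C=[-a_2]$). A dominant eigenvalue of $C$ is a complex eigenvalue $\lambda_1$ of $C$ of largest modulus, i.e. $|\lambda_1| \ge |\mu|$ for every eigenvalue $\mu \in \mathbb{C}$ of $C$. "Within the circle of radius $r$" means in the closed disc of radius $r$ centered at the origin. *)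

theory Defs
  imports "HOL-Computational_Algebra.Polynomial" "Jordan_Normal_Form.Char_Poly" Complex_Main
begin

(* Only a 2, ..., a (n + 1) matter; the other values of a are never used. *)
definition monic_poly :: "nat \<Rightarrow> (nat \<Rightarrow> real) \<Rightarrow> real poly" where
  "monic_poly n a = monom 1 n + (\<Sum>k = 2..n + 1. monom (a k) (n + 1 - k))"

(* Matrix entries are numbered from 0 here, so entry (0, j) of the first row is - a (j + 2). *)
definition companion_mat :: "nat \<Rightarrow> (nat \<Rightarrow> real) \<Rightarrow> complex mat" where
  "companion_mat n a = mat n n (\<lambda>(i, j).
     if i = 0 then - complex_of_real (a (j + 2))
     else if i = j + 1 then 1
     else 0)"

definition dominant_eigenvalue :: "complex mat \<Rightarrow> complex \<Rightarrow> bool" where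
  "dominant_eigenvalue A l \<longleftrightarrow>
     eigenvalue A l \<and> (\<forall>m. eigenvalue A m \<longrightarrow> cmod m \<le> cmod l)"

end

theory Submission
  imports Defs
begin

text \<open>Every root z of p is an eigenvalue of C, with the explicit eigenvector (z^(n-1), ..., z,
  1). The subdiagonal ones of C shift the powers down by one place, which on these rows is
  multiplication by z; the first row yields z^n exactly because p(z) = 0. This is
  \<open>eigenvector_companion_mat\<close>; dominance of \<open>l1\<close> then bounds the modulus
  of z.\<close>

lemma poly_monic_poly_of_real:
  fixes z :: "'a :: real_field"
  shows "poly (map_poly of_real (monic_poly n a)) z =
    z ^ n + (\<Sum>j<n. of_real (a (j + 2)) * z ^ (n - 1 - j))"
proof -
  interpret h: map_poly_comm_ring_hom "of_real :: real \<Rightarrow> 'a"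
    by unfold_locales auto
  have "poly (map_poly of_real (monic_poly n a)) z =
      z ^ n + (\<Sum>k = 2..n + 1. of_real (a k) * z ^ (n + 1 - k))"
    by (simp add: monic_poly_def h.hom_add h.hom_sum poly_sum map_poly_monom poly_monom)
  \<comment> \<open>The shift k = j + 2 passes to the column numbering of
    \<open>companion_mat\<close>, so that the sum becomes the negated product of the first row with
    the vector of powers.\<close>
  also have "(\<Sum>k = 2..n + 1. of_real (a k) * z ^ (n + 1 - k)) =
      (\<Sum>j<n. of_real (a (j + 2)) * z ^ (n - 1 - j))"
    by (rule sum.reindex_bij_witness[of _ "\<lambda>j. j + 2" "\<lambda>k. k - 2"])
      (auto dest!: le_Suc_ex)
  finally show ?thesis .
qed

lemma eigenvector_companion_mat:
  assumes "n \<ge> 1" and root: "poly (map_poly complex_of_real (monic_poly n a)) z = 0"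
  shows "eigenvector (companion_mat n a) (vec n (\<lambda>i. z ^ (n - 1 - i))) z"
proof -
  define v where "v = vec n (\<lambda>i. z ^ (n - 1 - i))"
  \<comment> \<open>The last entry is z^0, so v is nonzero even for z = 0.\<close>
  have "v $ (n - 1) = 1"
    using assms(1) by (simp add: v_def)
  then have "v \<noteq> 0\<^sub>v n"
    using assms(1) by auto
  moreover have "companion_mat n a *\<^sub>v v = z \<cdot>\<^sub>v v"
  proof (rule eq_vecI)
    fix i
    assume "i < dim_vec (z \<cdot>\<^sub>v v)"
    then have i: "i < n" by (simp add: v_def)
    have row: "(companion_mat n a *\<^sub>v v) $ i =
        (\<Sum>j<n. companion_mat n a $$ (i, j) * z ^ (n - 1 - j))"
      using i by (simp add: companion_mat_def v_def scalar_prod_def lessThan_atLeast0)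
    show "(companion_mat n a *\<^sub>v v) $ i = (z \<cdot>\<^sub>v v) $ i"
    proof (cases i)
      case 0
      have "(companion_mat n a *\<^sub>v v) $ i =
          - (\<Sum>j<n. complex_of_real (a (j + 2)) * z ^ (n - 1 - j))"
        unfolding row using i 0 by (simp add: companion_mat_def sum_negf)
      \<comment> \<open>The equation p(z) = 0, solved for its leading term.\<close>
      also have "\<dots> = z ^ n"
        using root by (simp add: poly_monic_poly_of_real add_eq_0_iff)
      also have "\<dots> = z * z ^ (n - 1)"
        using assms(1) by (simp add: power_eq_if)
      finally show ?thesis
        using i 0 by (simp add: v_def)
    next
      case (Suc k)
      \<comment> \<open>Below the first row, the only nonzero entry of row i = k + 1 is the 1 in
        column k.\<close>
      have "(companion_mat n a *\<^sub>v v) $ i =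
          (\<Sum>j<n. if j = k then z ^ (n - 1 - j) else 0)"
        unfolding row using i Suc by (intro sum.cong) (auto simp: companion_mat_def)
      also have "\<dots> = z ^ (n - 1 - k)"
        using i Suc by simp
      \<comment> \<open>Entry k of v carries one more factor z than entry i; i < n keeps the natural
        subtraction from truncating.\<close>
      also have "n - 1 - k = Suc (n - 1 - i)"
        using i Suc by simp
      finally show ?thesis
        using i by (simp add: v_def)
    qed
  qed (simp add: companion_mat_def v_def)
  ultimately show ?thesis
    by (simp add: eigenvector_def companion_mat_def v_def)
qed

theorem theorem3:
  fixes n :: nat
    and a :: "nat \<Rightarrow> real"
    and l1 :: complex
  assumes "n \<ge> 1"
    and "dominant_eigenvalue (companion_mat n a) l1"
  shows "\<forall>z::complex. poly (map_poly complex_of_real (monic_poly n a)) z = 0 \<longrightarrow> cmod z \<le> cmod l1"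
  using assms eigenvector_companion_mat
  unfolding dominant_eigenvalue_def eigenvalue_def by blast

end
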